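(* Let $\ell\ge1$ and $n\ge1$ be integers. For any integer $k\ge0$ there is a bijection $\Phi$ from $G_{\ell,n}$ onto itself such that for all $\pi\in G_{\ell,n}$, $$\mathcal{C}^{k+1}(\pi)=\mathcal{L}^{k+1}(\Phi(\pi))$$ and $$\mathcal{C}^{k}(\delta(\pi))=\mathcal{L}^{*(k+1)}(\Phi(\pi)).$$
   Context: Write $[n]=\{1,\dots,n\}$. For a fixed integer $\ell\ge1$, let $C_\ell$ be the cyclic group generated by $\zeta=e^{2i\pi/\ell}$. The group $G_{\ell,n}=C_\ell\wr S_n$ of colored permutations consists of the pairs $\pi=(\epsilon,\sigma)$ with $\epsilon=(\epsilon_1,\dots,\epsilon_n)\in C_\ell^n$ and $\sigma\in S_n$; $\pi$ is identified with the permutation of the colored set $\{\zeta^j i : i\in[n],\ 0\le j\le \ell-1\}$ (regarded as $C_\ell\times[n]$) given by $\pi(i)=\epsilon_{\sigma(i)}\sigma(i)$ and $\pi(\zeta^j i)=\zeta^j\pi(i)$ for $i\in[n]$. Write $|\pi|=\sigma$, and $|\pi(i)|=\sigma(i)$. The one-line form of $\pi$ is $\pi_1\pi_2\cdots\pi_n$ with $\pi_i=\pi(i)$. Convention: $\zeta^j i+k=\zeta^j(i+k)$ for $0\le k\le n-i$. For $k\ge0$, the value $\pi(i)$ is a $k$-circular succession of $\pi$ at position $i\in[n]$ if $\pi(i)=i+k$, where $i+k$ must be an uncolored element of $[n]$ (color $1$, no wraparound modulo $n$). $\mathcal{C}^k(\pi)$ is the set of $k$-circular successions (values) of $\pi$.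 For $k\ge1$, the value $|\pi(i)|$ with $2\le i\le n$ is a $k$-linear succession of $\pi$ at position $i$ if $\pi(i)=\pi(i-1)+k$ (so $\pi(i)$ and $\pi(i-1)$ have the same color and $|\pi(i)|=|\pi(i-1)|+k$). $\mathcal{L}^k(\pi)$ is the set of $k$-linear successions of $\pi$. For $k\ge1$, the value $|\pi(i)|$ with $1\le i\le n$ is a skew $k$-linear succession of $\pi$ at position $i$ if $\pi(i)=\pi(i-1)+k$, where by convention $\pi(0)=0$ with color $1$. $\mathcal{L}^{*k}(\pi)$ is the set of skew $k$-linear successions of $\pi$; thus $\mathcal{L}^{*k}(\pi)=\mathcal{L}^k(\pi)$ if $\pi(1)\ne k$, and $\mathcal{L}^{*k}(\pi)=\mathcal{L}^k(\pi)\cup\{k\}$ otherwise. The bijection $\delta:G_{\ell,n}\to G_{\ell,n}$ is defined on one-line forms by $\pi_1\pi_2\cdots\pi_n\mapsto \pi_n\pi_1\pi_2\cdots\pi_{n-1}$. *)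

theory Defs
  imports Complex_Main "HOL-Library.FuncSet" "HOL-Combinatorics.Permutations"
begin

definition zeta :: "nat \<Rightarrow> complex" where
  "zeta l = exp (2 * \<i> * of_real pi / of_nat l)"

definition colors :: "nat \<Rightarrow> complex set" where
  "colors l = {zeta l ^ j | j. j < l}"

text \<open>The colored letter \<open>\<zeta>\<^sup>j i\<close> is the pair \<open>(\<zeta>\<^sup>j, i)\<close>;
  an uncolored letter has color \<open>1\<close>.\<close>

type_synonym letter = "complex \<times> nat"
type_synonym colored_perm = "(nat \<Rightarrow> complex) \<times> (nat \<Rightarrow> nat)"

text \<open>Both components are pinned down outside \<open>{1..n}\<close> (the first is extensional, the second the
  identity there), so distinct pairs are distinct colored permutations.\<close>

definition colored_perms :: "nat \<Rightarrow> nat \<Rightarrow> colored_perm set" where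
  "colored_perms l n = ({1..n} \<rightarrow>\<^sub>E colors l) \<times> {\<sigma>. \<sigma> permutes {1..n}}"

text \<open>Colors are indexed by values, not by positions:
  \<open>\<pi>(i) = \<epsilon>\<^bsub>\<sigma>(i)\<^esub> \<sigma>(i)\<close>.\<close>

definition letter_at :: "colored_perm \<Rightarrow> nat \<Rightarrow> letter" where
  "letter_at \<pi> i = (fst \<pi> (snd \<pi> i), snd \<pi> i)"

definition one_line :: "nat \<Rightarrow> colored_perm \<Rightarrow> letter list" where
  "one_line n \<pi> = map (letter_at \<pi>) [1..<n + 1]"

definition shift :: "letter \<Rightarrow> nat \<Rightarrow> letter" where
  "shift x k = (fst x, snd x + k)"

text \<open>A circular succession is an uncolored letter, identified with its value in \<open>{1..n}\<close>.\<close>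

definition circular_successions :: "nat \<Rightarrow> nat \<Rightarrow> colored_perm \<Rightarrow> nat set" where
  "circular_successions n k \<pi> =
     {i + k | i. i \<in> {1..n} \<and> i + k \<in> {1..n} \<and> letter_at \<pi> i = (1, i + k)}"

definition linear_successions :: "nat \<Rightarrow> nat \<Rightarrow> colored_perm \<Rightarrow> nat set" where
  "linear_successions n k \<pi> =
     {snd (letter_at \<pi> i) | i. i \<in> {2..n} \<and> letter_at \<pi> i = shift (letter_at \<pi> (i - 1)) k}"

text \<open>\<open>letter_at\<close> with the convention \<open>\<pi>(0) = 0\<close>, of color \<open>1\<close>.\<close>

definition letter_at0 :: "colored_perm \<Rightarrow> nat \<Rightarrow> letter" where
  "letter_at0 \<pi> i = (if i = 0 then (1, 0) else letter_at \<pi> i)"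

definition skew_linear_successions :: "nat \<Rightarrow> nat \<Rightarrow> colored_perm \<Rightarrow> nat set" where
  "skew_linear_successions n k \<pi> =
     {snd (letter_at0 \<pi> i) | i. i \<in> {1..n} \<and> letter_at0 \<pi> i = shift (letter_at0 \<pi> (i - 1)) k}"

definition delta :: "nat \<Rightarrow> nat \<Rightarrow> colored_perm \<Rightarrow> colored_perm" where
  "delta l n \<pi> = (THE \<rho>. \<rho> \<in> colored_perms l n \<and>
     one_line n \<rho> = last (one_line n \<pi>) # butlast (one_line n \<pi>))"

lemma one_line_nth:
  assumes "i \<in> {1..n}"
  shows "one_line n \<pi> ! (i - 1) = letter_at \<pi> i"
proof -
  have "i - 1 < length [1..<n + 1]" using assms by simp linarith
  then have "one_line n \<pi> ! (i - 1) = letter_at \<pi> ([1..<n + 1] ! (i - 1))"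
    unfolding one_line_def by (rule nth_map)
  also have "[1..<n + 1] ! (i - 1) = i"
    using assms by (subst nth_upt) auto
  finally show ?thesis .
qed

lemma length_one_line: "length (one_line n \<pi>) = n"
  by (simp add: one_line_def del: upt_Suc)

lemma one_line_inj: "inj_on (one_line n) (colored_perms l n)"
proof (rule inj_onI)
  fix \<pi> \<rho> assume P: "\<pi> \<in> colored_perms l n" and R: "\<rho> \<in> colored_perms l n"
    and eq: "one_line n \<pi> = one_line n \<rho>"
  obtain e s where p: "\<pi> = (e, s)" by (cases \<pi>)
  obtain f t where r: "\<rho> = (f, t)" by (cases \<rho>)
  have sp: "s permutes {1..n}" and tp: "t permutes {1..n}"
    and e: "e \<in> {1..n} \<rightarrow>\<^sub>E colors l" and f: "f \<in> {1..n} \<rightarrow>\<^sub>E colors l"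
    using P R by (auto simp: p r colored_perms_def)
  have at: "letter_at \<pi> i = letter_at \<rho> i" if "i \<in> {1..n}" for i
    using one_line_nth[OF that] eq by metis
  have st: "s = t"
  proof
    fix i show "s i = t i"
    proof (cases "i \<in> {1..n}")
      case True then show ?thesis using at[OF True] by (simp add: p r letter_at_def)
    next
      case False then show ?thesis using sp tp by (simp add: permutes_not_in)
    qed
  qed
  have "e = f"
  proof (rule PiE_ext[OF e f])
    fix v assume "v \<in> {1..n}"
    then obtain i where i: "i \<in> {1..n}" "v = s i"
      using permutes_image[OF sp] by (metis imageE)
    then show "e v = f v" using at[OF i(1)] by (simp add: p r letter_at_def st)
  qed
  with st show "\<pi> = \<rho>" by (simp add: p r)
qed

lemma rotate_permutes:
  fixes n :: nat
  assumes "n \<ge> 1"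
  shows "(\<lambda>i. if i = 1 then n else if i \<in> {2..n} then i - 1 else i) permutes {1..n}"
proof (rule bij_imp_permutes)
  show "bij_betw (\<lambda>i. if i = 1 then n else if i \<in> {2..n} then i - 1 else i) {1..n} {1..n}"
    by (rule bij_betw_byWitness[where f' = "\<lambda>i. if i = n then 1 else i + 1"])
       (use assms in \<open>auto split: if_splits\<close>)
qed (use assms in auto)

lemma delta_props:
  assumes n: "n \<ge> 1" and P: "\<pi> \<in> colored_perms l n"
  shows delta_in: "delta l n \<pi> \<in> colored_perms l n"
    and one_line_delta: "one_line n (delta l n \<pi>) = last (one_line n \<pi>) # butlast (one_line n \<pi>)"
proof -
  define c where "c = (\<lambda>i. if i = 1 then n else if i \<in> {2..n} then i - 1 else i)"
  define \<rho> where "\<rho> = (fst \<pi>, snd \<pi> \<circ> c)"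
  have "c permutes {1..n}" unfolding c_def by (rule rotate_permutes[OF n])
  then have R: "\<rho> \<in> colored_perms l n"
    using P by (auto simp: colored_perms_def \<rho>_def intro: permutes_compose)
  have ne: "one_line n \<pi> \<noteq> []" using n length_one_line[of n \<pi>] by auto
  have "one_line n \<rho> = last (one_line n \<pi>) # butlast (one_line n \<pi>)"
  proof (rule nth_equalityI)
    show "length (one_line n \<rho>) = length (last (one_line n \<pi>) # butlast (one_line n \<pi>))"
      using n by (simp add: length_one_line)
    fix i assume "i < length (one_line n \<rho>)"
    then have i: "i < n" by (simp add: length_one_line)
    have "one_line n \<rho> ! i = letter_at \<pi> (c (i + 1))"
      using i one_line_nth[of "i + 1" n \<rho>] by (simp add: letter_at_def \<rho>_def)
    also have "\<dots> = (last (one_line n \<pi>) # butlast (one_line n \<pi>)) ! i"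
    proof (cases i)
      case 0
      then show ?thesis
        using n ne one_line_nth[of n n \<pi>] by (simp add: c_def last_conv_nth length_one_line)
    next
      case (Suc j)
      then show ?thesis
        using i one_line_nth[of i n \<pi>] by (simp add: c_def nth_butlast length_one_line)
    qed
    finally show "one_line n \<rho> ! i = (last (one_line n \<pi>) # butlast (one_line n \<pi>)) ! i" .
  qed
  with R have ex: "\<exists>!\<rho>. \<rho> \<in> colored_perms l n \<and>
      one_line n \<rho> = last (one_line n \<pi>) # butlast (one_line n \<pi>)"
    using one_line_inj[of n l] by (metis inj_onD)
  show "delta l n \<pi> \<in> colored_perms l n"
    and "one_line n (delta l n \<pi>) = last (one_line n \<pi>) # butlast (one_line n \<pi>)"
    using theI'[OF ex] by (auto simp: delta_def)
qed

lemma skew_linear_successions_eq: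
  assumes "n \<ge> 1"
  shows "skew_linear_successions n k \<pi> =
    (if letter_at \<pi> 1 = (1, k) then insert k (linear_successions n k \<pi>) else linear_successions n k \<pi>)"
proof -
  have split: "{1..n} = insert 1 {2..n}" using assms by auto
  have at0: "letter_at0 \<pi> i = letter_at \<pi> i" "letter_at0 \<pi> (i - 1) = letter_at \<pi> (i - 1)"
    if "i \<in> {2..n}" for i
    using that by (auto simp: letter_at0_def)
  have one: "letter_at0 \<pi> 1 = letter_at \<pi> 1" "letter_at0 \<pi> (1 - 1) = (1, 0)"
    by (auto simp: letter_at0_def)
  have "skew_linear_successions n k \<pi> =
      {snd (letter_at0 \<pi> i) | i. i = 1 \<and> letter_at0 \<pi> i = shift (letter_at0 \<pi> (i - 1)) k} \<union>
      {snd (letter_at0 \<pi> i) | i. i \<in> {2..n} \<and> letter_at0 \<pi> i = shift (letter_at0 \<pi> (i - 1)) k}"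
    unfolding skew_linear_successions_def split by blast
  also have "{snd (letter_at0 \<pi> i) | i. i \<in> {2..n} \<and> letter_at0 \<pi> i = shift (letter_at0 \<pi> (i - 1)) k}
      = linear_successions n k \<pi>"
    unfolding linear_successions_def using at0 by (metis (no_types, lifting))
  also have "{snd (letter_at0 \<pi> i) | i. i = 1 \<and> letter_at0 \<pi> i = shift (letter_at0 \<pi> (i - 1)) k}
      = (if letter_at \<pi> 1 = (1, k) then {k} else {})"
    using one by (auto simp: shift_def)
  finally show ?thesis by auto
qed

end

theory Submission
  imports Defs
begin

text \<open>
  Rotating by \<open>\<delta>\<close> reduces everything to one equidistribution. With \<open>m = k + 1\<close>, the set
  \<open>C\<^sup>k(\<delta>(\<pi>))\<close> differs from \<open>C\<^sup>m(\<pi>)\<close> at most by the element \<open>m\<close>, and so does the set of skew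
  \<open>m\<close>-linear successions of a colored permutation from its set of \<open>m\<close>-linear ones; moreover \<open>m\<close> lies
  in neither of the smaller sets. Hence the second required identity implies the first, and since
  \<open>\<delta>\<close> is a bijection it suffices to find a bijection \<open>\<Psi>\<close> of the colored permutations with
  \<open>L\<^sup>*\<^sup>m(\<Psi>(\<rho>)) = C\<^sup>k(\<rho>)\<close>; then \<open>\<Phi> = \<Psi> \<circ> \<delta>\<close>.

  Such a \<open>\<Psi>\<close> exists once both statistics take each value \<open>T\<close> equally often. By inclusion-exclusion
  it is enough that, for each \<open>T \<subseteq> {m..n}\<close>, equally many colored permutations have a value
  \<^emph>\<open>containing\<close> \<open>T\<close> (\<open>card_fibres_eq_if_card_supersets_eq\<close>).

  Both numbers equal the number of colored arrangements of \<open>{1..n} - T\<close>. The reason is the same for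
  both statistics: a succession of the word \<open>w = \<pi>\<^sub>1 \<dots> \<pi>\<^sub>n\<close> is a letter that agrees with a prediction
  made from the prefix in front of it. For circular successions the prediction is the uncolored
  letter whose value is the length of the prefix plus \<open>m\<close>; for skew linear successions it is the last
  letter of the prefix, the empty prefix counting as \<open>0\<close>, shifted by \<open>m\<close>. If the largest element \<open>v\<close>
  of \<open>T\<close> is a succession of \<open>w\<close>, deleting its letter keeps the smaller successions, and the letter can
  be restored because exactly one prefix of the shortened word predicts \<open>v\<close>
  (\<open>bij_betw_delete_predicted\<close>). Deleting the elements of \<open>T\<close> in decreasing order leaves an arbitrary
  colored arrangement of \<open>{1..n} - T\<close> (\<open>card_words_predicted\<close>).
\<close>

section \<open>Equidistribution of set-valued statistics\<close>

text \<open>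
  Inclusion-exclusion in recursive form: the points with \<open>f x \<supseteq> T\<close> split into those with \<open>f x = T\<close>
  and the fibres over the proper supersets of \<open>T\<close>, which are already known to agree.
\<close>

lemma card_fibres_eq_if_card_supersets_eq:
  fixes f g :: "'a \<Rightarrow> 'b set"
  assumes X: "finite X" and U: "finite U"
    and f: "\<And>x. x \<in> X \<Longrightarrow> f x \<subseteq> U" and g: "\<And>x. x \<in> X \<Longrightarrow> g x \<subseteq> U"
    and sup: "\<And>T. T \<subseteq> U \<Longrightarrow> card {x \<in> X. T \<subseteq> f x} = card {x \<in> X. T \<subseteq> g x}"
    and T: "T \<subseteq> U"
  shows "card {x \<in> X. f x = T} = card {x \<in> X. g x = T}"
  using T
proof (induction "card (U - T)" arbitrary: T rule: less_induct)
  case less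
  let ?S = "{S. T \<subset> S \<and> S \<subseteq> U}"
  have split: "card {x \<in> X. T \<subseteq> F x} = card {x \<in> X. F x = T} + (\<Sum>S\<in>?S. card {x \<in> X. F x = S})"
    if F: "\<And>x. x \<in> X \<Longrightarrow> F x \<subseteq> U" for F :: "'a \<Rightarrow> 'b set"
  proof -
    have "{x \<in> X. T \<subseteq> F x} = {x \<in> X. F x = T} \<union> (\<Union>S\<in>?S. {x \<in> X. F x = S})"
      using F by blast
    moreover have "card (\<Union>S\<in>?S. {x \<in> X. F x = S}) = (\<Sum>S\<in>?S. card {x \<in> X. F x = S})"
      using X U by (intro card_UN_disjoint) auto
    moreover have "card ({x \<in> X. F x = T} \<union> (\<Union>S\<in>?S. {x \<in> X. F x = S}))
        = card {x \<in> X. F x = T} + card (\<Union>S\<in>?S. {x \<in> X. F x = S})"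
    proof (rule card_Un_disjoint)
      show "finite (\<Union>S\<in>?S. {x \<in> X. F x = S})"
        by (rule finite_subset[OF _ X]) auto
    qed (use X in auto)
    ultimately show ?thesis by simp
  qed
  have "card {x \<in> X. f x = S} = card {x \<in> X. g x = S}" if "S \<in> ?S" for S
    using that U by (intro less.hyps psubset_card_mono) auto
  then have "(\<Sum>S\<in>?S. card {x \<in> X. f x = S}) = (\<Sum>S\<in>?S. card {x \<in> X. g x = S})"
    by simp
  with split[of f, OF f] split[of g, OF g] sup[OF less.prems] show ?case
    by linarith
qed

lemma bij_betw_if_card_fibres_eq:
  assumes X: "finite X"
    and fib: "\<And>T. card {x \<in> X. f x = T} = card {x \<in> X. g x = T}"
  shows "\<exists>\<Psi>. bij_betw \<Psi> X X \<and> (\<forall>x\<in>X. g (\<Psi> x) = f x)"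
proof -
  have "\<forall>T. \<exists>h. bij_betw h {x \<in> X. f x = T} {x \<in> X. g x = T}"
    using X fib by (intro allI finite_same_card_bij) auto
  then obtain h where h: "\<And>T. bij_betw (h T) {x \<in> X. f x = T} {x \<in> X. g x = T}"
    by metis
  define \<Psi> where "\<Psi> x = h (f x) x" for x
  have into: "\<Psi> x \<in> X" "g (\<Psi> x) = f x" if "x \<in> X" for x
    using bij_betwE[OF h[of "f x"]] that by (auto simp: \<Psi>_def)
  have "inj_on \<Psi> X"
  proof (rule inj_onI)
    fix x y assume xy: "x \<in> X" "y \<in> X" "\<Psi> x = \<Psi> y"
    then have "f x = f y" using into by metis
    then show "x = y"
      using xy bij_betw_imp_inj_on[OF h[of "f x"]] by (auto simp: \<Psi>_def dest: inj_onD)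
  qed
  moreover have "\<Psi> ` X \<subseteq> X" using into by auto
  ultimately have "bij_betw \<Psi> X X"
    using X by (simp add: bij_betw_def endo_inj_surj)
  with into show ?thesis by blast
qed

section \<open>Colored words and predicted letters\<close>

text \<open>
  Arrangements of an arbitrary set of values are needed, not only of \<open>{1..n}\<close>, because deleting a letter
  from a colored permutation leaves a gap in its values.
\<close>

definition words :: "complex set \<Rightarrow> nat set \<Rightarrow> letter list set" where
  "words K A = {w. distinct (map snd w) \<and> snd ` set w = A \<and> fst ` set w \<subseteq> K}"

text \<open>
  A rule \<open>h\<close> reads a prefix and announces the next letter. The values of the letters announced
  correctly form a common abstraction of circular and of skew linear successions.
\<close>

definition predicted :: "(letter list \<Rightarrow> letter) \<Rightarrow> letter list \<Rightarrow> nat set" where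
  "predicted h w = {v. \<exists>xs c ys. w = xs @ (c, v) # ys \<and> h xs = (c, v)}"

lemma predicted_append:
  "predicted h (xs @ ys) = predicted h xs \<union> predicted (\<lambda>zs. h (xs @ zs)) ys"
proof (intro set_eqI iffI)
  fix v assume "v \<in> predicted h (xs @ ys)"
  then obtain as c bs where "xs @ ys = as @ (c, v) # bs" "h as = (c, v)"
    by (auto simp: predicted_def)
  then show "v \<in> predicted h xs \<union> predicted (\<lambda>zs. h (xs @ zs)) ys"
    by (fastforce simp: predicted_def append_eq_append_conv2 Cons_eq_append_conv
        append_eq_Cons_conv)
next
  fix v assume "v \<in> predicted h xs \<union> predicted (\<lambda>zs. h (xs @ zs)) ys"
  then consider as c bs where "xs = as @ (c, v) # bs" "h as = (c, v)"
    | as c bs where "ys = as @ (c, v) # bs" "h (xs @ as) = (c, v)"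
    by (auto simp: predicted_def)
  then show "v \<in> predicted h (xs @ ys)"
  proof cases
    case (1 as c bs)
    then have "xs @ ys = as @ (c, v) # (bs @ ys)" by simp
    with 1(2) show ?thesis unfolding predicted_def by blast
  next
    case (2 as c bs)
    then have "xs @ ys = (xs @ as) @ (c, v) # bs" by simp
    with 2(2) show ?thesis unfolding predicted_def by blast
  qed
qed

lemma predicted_Cons:
  "predicted h (x # ys) = (if h [] = x then {snd x} else {}) \<union> predicted (\<lambda>zs. h (x # zs)) ys"
proof -
  have "predicted h [x] = (if h [] = x then {snd x} else {})"
    by (cases x) (auto simp: predicted_def Cons_eq_append_conv)
  then show ?thesis using predicted_append[of h "[x]" ys] by simp
qed

lemma predicted_nth:
  "predicted h w = {snd (w ! i) | i. i < length w \<and> w ! i = h (take i w)}"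
proof (intro set_eqI iffI)
  fix v assume "v \<in> predicted h w"
  then obtain xs c ys where "w = xs @ (c, v) # ys" "h xs = (c, v)"
    by (auto simp: predicted_def)
  then show "v \<in> {snd (w ! i) | i. i < length w \<and> w ! i = h (take i w)}"
    by (auto intro!: exI[of _ "length xs"])
next
  fix v assume "v \<in> {snd (w ! i) | i. i < length w \<and> w ! i = h (take i w)}"
  then obtain i where "i < length w" "w ! i = h (take i w)" "v = snd (w ! i)" by blast
  then show "v \<in> predicted h w"
    unfolding predicted_def using id_take_nth_drop[of i w]
    by (metis (mono_tags, lifting) mem_Collect_eq prod.collapse)
qed

section \<open>Counting words with prescribed predicted letters\<close>

text \<open>
  What the deletion argument needs of a prediction rule. The value \<open>v\<close> is predicted at no more than one
  place of a word (\<open>prefix_unique\<close>) and, while all smaller values are still present, at some place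
  and with an available color (\<open>prefix_exists\<close>). A correctly predicted letter does not affect whether
  a smaller value behind it is predicted (\<open>insertion_invisible\<close>); this is why the largest value has to
  be deleted first. Words avoid the value \<open>0\<close>, which is reserved for the virtual letter in front of a
  word.
\<close>

locale prediction =
  fixes K :: "complex set" and m :: nat and h :: "letter list \<Rightarrow> letter"
  assumes prefix_unique:
      "\<lbrakk>xs @ ys \<in> words K A; 0 \<notin> A; xs @ ys = xs' @ ys'; snd (h xs) = snd (h xs')\<rbrakk> \<Longrightarrow> xs = xs'"
    and insertion_invisible:
      "\<lbrakk>h xs = (c, v); u < v\<rbrakk> \<Longrightarrow> h (xs @ (c, v) # zs) = (d, u) \<longleftrightarrow> h (xs @ zs) = (d, u)"
    and prefix_exists:
      "\<lbrakk>w \<in> words K A; 0 \<notin> A; {1..<v} \<subseteq> A; m \<le> v\<rbrakk>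
        \<Longrightarrow> \<exists>xs ys. w = xs @ ys \<and> snd (h xs) = v \<and> fst (h xs) \<in> K"
begin

lemma predicted_insert:
  assumes "h xs = (c, v)" and "u < v"
  shows "u \<in> predicted h (xs @ (c, v) # ys) \<longleftrightarrow> u \<in> predicted h (xs @ ys)"
  using assms insertion_invisible[OF assms]
  by (simp add: predicted_append predicted_Cons) (simp add: predicted_def)

text \<open>
  The inverse map inserts \<open>v\<close>, colored as predicted, behind the only prefix that predicts \<open>v\<close>.
\<close>

lemma bij_betw_delete_predicted:
  assumes A: "0 \<notin> A" and v: "{1..v} \<subseteq> A" "1 \<le> v" "m \<le> v" and T: "\<And>u. u \<in> T \<Longrightarrow> u < v"
  shows "bij_betw (filter (\<lambda>x. snd x \<noteq> v))
    {w \<in> words K A. insert v T \<subseteq> predicted h w} {w \<in> words K (A - {v}). T \<subseteq> predicted h w}"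
    (is "bij_betw ?r ?X ?Y")
proof -
  have vA: "v \<in> A" using v by auto
  have dec: "\<exists>xs c ys. w = xs @ (c, v) # ys \<and> h xs = (c, v) \<and> ?r w = xs @ ys \<and>
      xs @ ys \<in> words K (A - {v})"
    if w: "w \<in> words K A" "v \<in> predicted h w" for w
  proof -
    obtain xs c ys where x: "w = xs @ (c, v) # ys" "h xs = (c, v)"
      using w by (auto simp: predicted_def)
    have nv: "v \<notin> snd ` set xs" "v \<notin> snd ` set ys"
      using w x by (auto simp: words_def)
    then have "?r xs = xs" "?r ys = ys" by (auto simp: filter_id_conv)
    moreover have "xs @ ys \<in> words K (A - {v})"
      using w x nv by (auto simp: words_def)
    ultimately show ?thesis using x by auto
  qed
  have T': "T \<subseteq> predicted h (xs @ (c, v) # ys) \<longleftrightarrow> T \<subseteq> predicted h (xs @ ys)"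
    if "h xs = (c, v)" for xs c ys
    using predicted_insert[OF that] T by blast
  show ?thesis
  proof (rule bij_betw_imageI)
    show "inj_on ?r ?X"
    proof (rule inj_onI)
      fix w w' assume "w \<in> ?X" "w' \<in> ?X" and eq: "?r w = ?r w'"
      with dec obtain xs c ys xs' c' ys' where
        x: "w = xs @ (c, v) # ys" "h xs = (c, v)" "?r w = xs @ ys" "xs @ ys \<in> words K (A - {v})"
        and x': "w' = xs' @ (c', v) # ys'" "h xs' = (c', v)" "?r w' = xs' @ ys'"
        by (metis (no_types, lifting) insert_subset mem_Collect_eq)
      have "xs = xs'"
        using prefix_unique[OF x(4), of xs' ys'] x x' eq A by auto
      then show "w = w'" using x x' eq by simp
    qed
    show "?r ` ?X = ?Y"
    proof (intro equalityI subsetI)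
      fix w' assume "w' \<in> ?r ` ?X"
      then obtain w where w: "w \<in> words K A" "v \<in> predicted h w" "T \<subseteq> predicted h w" "w' = ?r w"
        by auto
      with dec[of w] T' show "w' \<in> ?Y" by auto
    next
      fix w' assume w': "w' \<in> ?Y"
      have "{1..<v} \<subseteq> A - {v}" using v by auto
      with prefix_exists[of w' "A - {v}" v] w' A v obtain xs ys
        where x: "w' = xs @ ys" "snd (h xs) = v" "fst (h xs) \<in> K" by auto
      define c where "c = fst (h xs)"
      have hx: "h xs = (c, v)" using x by (simp add: c_def prod_eq_iff)
      let ?w = "xs @ (c, v) # ys"
      have nv: "v \<notin> snd ` set xs" "v \<notin> snd ` set ys"
        using w' x(1) by (auto simp: words_def)
      have "?w \<in> words K A"
        using w' x nv vA by (auto simp: words_def c_def)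
      moreover have "insert v T \<subseteq> predicted h ?w"
        using T'[OF hx] w' x(1) hx by (auto simp: predicted_def)
      moreover have "?r ?w = w'"
      proof -
        have "?r xs = xs" "?r ys = ys" using nv by (auto simp: filter_id_conv)
        then show ?thesis using x by simp
      qed
      ultimately show "w' \<in> ?r ` ?X" by (metis (mono_tags, lifting) imageI mem_Collect_eq)
    qed
  qed
qed

text \<open>
  Deletion in decreasing order keeps the hypothesis \<open>{1..v} \<subseteq> A\<close> alive for the values \<open>v\<close> of \<open>T\<close> still
  to be deleted. The right-hand side does not mention \<open>h\<close>, so that any two prediction rules can be
  compared.
\<close>

lemma card_words_predicted:
  assumes "finite T" and "0 \<notin> A" and "\<And>v. v \<in> T \<Longrightarrow> {1..v} \<subseteq> A \<and> 1 \<le> v \<and> m \<le> v"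
  shows "card {w \<in> words K A. T \<subseteq> predicted h w} = card (words K (A - T))"
  using assms
proof (induction T arbitrary: A rule: finite_linorder_max_induct)
  case empty
  then show ?case by simp
next
  case (insert v T)
  have "card {w \<in> words K A. insert v T \<subseteq> predicted h w}
      = card {w \<in> words K (A - {v}). T \<subseteq> predicted h w}"
    using insert by (intro bij_betw_same_card[OF bij_betw_delete_predicted]) auto
  also have "\<dots> = card (words K (A - {v} - T))"
    using insert.prems insert.hyps by (intro insert.IH) fastforce+
  also have "A - {v} - T = A - insert v T" by blast
  finally show ?case .
qed

end

section \<open>The two predictions\<close>

definition predict_circular :: "nat \<Rightarrow> letter list \<Rightarrow> letter" where
  "predict_circular m xs = (1, length xs + m)"

definition predict_linear :: "nat \<Rightarrow> letter list \<Rightarrow> letter" where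
  "predict_linear m xs = shift (last ((1, 0) # xs)) m"

lemma length_word: "w \<in> words K A \<Longrightarrow> length w = card A"
  unfolding words_def by (metis (mono_tags, lifting) distinct_card length_map list.set_map mem_Collect_eq)

text \<open>
  The place where \<open>v\<close> is predicted is fixed by its distance from the start of the word. Larger values
  belong further to the right, so inserting or deleting \<open>v\<close> moves no position at which a smaller value is
  predicted. Since \<open>m \<ge> 1\<close>, the \<open>v - 1\<close> smaller values make the word long enough to contain the place.
\<close>

lemma prediction_circular:
  assumes "1 \<in> K" and "1 \<le> m"
  shows "prediction K m (predict_circular m)"
proof
  fix xs ys xs' ys' :: "letter list"
  assume "xs @ ys = xs' @ ys'" "snd (predict_circular m xs) = snd (predict_circular m xs')"
  then show "xs = xs'" by (simp add: predict_circular_def)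
next
  fix xs zs :: "letter list" and c d :: complex and u v :: nat
  assume "predict_circular m xs = (c, v)" "u < v"
  then show "predict_circular m (xs @ (c, v) # zs) = (d, u) \<longleftrightarrow>
      predict_circular m (xs @ zs) = (d, u)"
    by (auto simp: predict_circular_def)
next
  fix w :: "letter list" and A v
  assume w: "w \<in> words K A" and A: "{1..<v} \<subseteq> A" and v: "m \<le> v"
  have "finite A" using w by (auto simp: words_def)
  then have "v - 1 \<le> length w"
    using card_mono[OF _ A] length_word[OF w] by simp
  then have "length (take (v - m) w) = v - m" using assms by simp
  then show "\<exists>xs ys. w = xs @ ys \<and> snd (predict_circular m xs) = v \<and> fst (predict_circular m xs) \<in> K"
    using assms v
    by (intro exI[of _ "take (v - m) w"] exI[of _ "drop (v - m) w"]) (simp add: predict_circular_def)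
qed

text \<open>
  The place where \<open>v\<close> is predicted is right behind \<open>v - m\<close>. Inserting \<open>v\<close> there changes the predecessor
  of the next letter only, and neither \<open>v - m\<close> nor \<open>v\<close> predicts a value below \<open>v\<close>.
\<close>

lemma prediction_linear:
  assumes K: "1 \<in> K" and m: "1 \<le> m"
  shows "prediction K m (predict_linear m)"
proof
  fix xs ys xs' ys' :: "letter list" and A
  assume w: "xs @ ys \<in> words K A" and A: "0 \<notin> A" and eq: "xs @ ys = xs' @ ys'"
    and h: "snd (predict_linear m xs) = snd (predict_linear m xs')"
  \<comment> \<open>With the virtual letter in front, the value preceding a split point sits at the index given by
    the length of the prefix.\<close>
  let ?w = "map snd ((1, 0) # xs @ ys)"
  have dist: "distinct ?w" using w A by (auto simp: words_def)
  have at: "snd (last ((1, 0) # zs)) = ?w ! length zs" if "xs @ ys = zs @ zs'" for zs zs'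
    unfolding that by (cases zs rule: rev_cases) (auto simp: nth_append)
  have "length xs < length ?w" by simp
  moreover have "length xs' < length ?w" using eq by simp
  moreover have "?w ! length xs = ?w ! length xs'"
    using h at[of xs ys] at[of xs' ys'] eq by (simp add: predict_linear_def shift_def)
  ultimately have "length xs = length xs'" using dist nth_eq_iff_index_eq by blast
  then show "xs = xs'" using eq by simp
next
  fix xs zs :: "letter list" and c d :: complex and u v :: nat
  assume "predict_linear m xs = (c, v)" "u < v"
  then show "predict_linear m (xs @ (c, v) # zs) = (d, u) \<longleftrightarrow>
      predict_linear m (xs @ zs) = (d, u)"
    by (cases zs rule: rev_cases) (auto simp: predict_linear_def shift_def)
next
  fix w :: "letter list" and A v
  assume w: "w \<in> words K A" and A: "{1..<v} \<subseteq> A" and v: "m \<le> v"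
  show "\<exists>xs ys. w = xs @ ys \<and> snd (predict_linear m xs) = v \<and> fst (predict_linear m xs) \<in> K"
  proof (cases "v = m")
    case True
    then show ?thesis using K
      by (intro exI[of _ "[]"] exI[of _ w]) (simp add: predict_linear_def shift_def)
  next
    case False
    then have "v - m \<in> A" using A v m by auto
    then obtain c where "(c, v - m) \<in> set w" using w by (force simp: words_def)
    then obtain xs ys where x: "w = xs @ (c, v - m) # ys" by (meson split_list)
    then have "c \<in> K" using w by (auto simp: words_def)
    then show ?thesis using x v
      by (intro exI[of _ "xs @ [(c, v - m)]"] exI[of _ ys]) (simp add: predict_linear_def shift_def)
  qed
qed

section \<open>Colored permutations as words\<close>

lemma nth_one_line: "i < n \<Longrightarrow> one_line n \<pi> ! i = letter_at \<pi> (Suc i)"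
  using one_line_nth[of "Suc i" n \<pi>] by simp

lemma bij_betw_one_line: "bij_betw (one_line n) (colored_perms l n) (words (colors l) {1..n})"
proof (rule bij_betw_imageI[OF one_line_inj], intro equalityI subsetI)
  fix w assume "w \<in> one_line n ` colored_perms l n"
  then obtain \<epsilon> \<sigma> where w: "w = one_line n (\<epsilon>, \<sigma>)"
    and e: "\<epsilon> \<in> {1..n} \<rightarrow>\<^sub>E colors l" and s: "\<sigma> permutes {1..n}"
    by (auto simp: colored_perms_def)
  have set: "set [1..<n + 1] = {1..n}" by auto
  have ms: "map snd w = map \<sigma> [1..<n + 1]"
    by (simp add: w one_line_def letter_at_def del: upt_Suc)
  then have "distinct (map snd w)"
    by (simp add: distinct_map permutes_inj_on[OF s] del: upt_Suc)
  moreover have "snd ` set w = {1..n}"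
    using ms set permutes_image[OF s] by (metis list.set_map)
  moreover have "fst ` set w \<subseteq> colors l"
    using e permutes_in_image[OF s] set
    by (auto simp: w one_line_def letter_at_def simp del: upt_Suc)
  ultimately show "w \<in> words (colors l) {1..n}" by (simp add: words_def)
next
  fix w assume w: "w \<in> words (colors l) {1..n}"
  then have len: "length w = n" by (simp add: length_word)
  define \<sigma> where "\<sigma> i = (if i \<in> {1..n} then snd (w ! (i - 1)) else i)" for i
  define \<epsilon> where "\<epsilon> = restrict (\<lambda>v. fst (w ! (inv \<sigma> v - 1))) {1..n}"
  have mem: "w ! (i - 1) \<in> set w" if "i \<in> {1..n}" for i using that len by auto
  have inj: "inj_on \<sigma> {1..n}"
  proof (rule inj_onI)
    fix i j assume ij: "i \<in> {1..n}" "j \<in> {1..n}" "\<sigma> i = \<sigma> j"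
    then have "map snd w ! (i - 1) = map snd w ! (j - 1)" using len by (auto simp: \<sigma>_def)
    then have "i - 1 = j - 1"
      using w ij len by (subst (asm) nth_eq_iff_index_eq) (auto simp: words_def)
    then show "i = j" using ij by auto
  qed
  moreover have "\<sigma> ` {1..n} \<subseteq> {1..n}"
    using mem w by (auto simp: \<sigma>_def words_def)
  ultimately have "bij_betw \<sigma> {1..n} {1..n}"
    by (simp add: bij_betw_def endo_inj_surj)
  then have s: "\<sigma> permutes {1..n}"
    by (rule bij_imp_permutes) (auto simp: \<sigma>_def)
  have inv: "inv \<sigma> v \<in> {1..n}" if "v \<in> {1..n}" for v
    using permutes_in_image[OF permutes_inv[OF s]] that by simp
  have "(\<epsilon>, \<sigma>) \<in> colored_perms l n"
    using s mem[OF inv] w by (auto simp: colored_perms_def \<epsilon>_def words_def)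
  moreover have "one_line n (\<epsilon>, \<sigma>) = w"
  proof (rule nth_equalityI)
    fix i assume "i < length (one_line n (\<epsilon>, \<sigma>))"
    then have i: "i < n" by (simp add: length_one_line)
    have "\<sigma> (Suc i) \<in> {1..n}" using permutes_in_image[OF s] i by auto
    then have "letter_at (\<epsilon>, \<sigma>) (Suc i) = (fst (w ! i), \<sigma> (Suc i))"
      using permutes_inverses(2)[OF s] by (simp add: letter_at_def \<epsilon>_def)
    then show "one_line n (\<epsilon>, \<sigma>) ! i = w ! i"
      using i by (simp add: nth_one_line \<sigma>_def)
  qed (simp add: len length_one_line)
  ultimately show "w \<in> one_line n ` colored_perms l n" by (metis imageI)
qed

lemma finite_colored_perms: "finite (colored_perms l n)"
proof -
  have "colors l = (\<lambda>j. zeta l ^ j) ` {..<l}" by (auto simp: colors_def)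
  then have "finite (colors l)" by simp
  then show ?thesis by (auto simp: colored_perms_def intro!: finite_PiE finite_permutations)
qed

text \<open>
  The shift grows from \<open>k\<close> to \<open>k + 1\<close> because the prefix in front of position \<open>i\<close> has length \<open>i - 1\<close>.
\<close>

lemma circular_successions_predicted:
  assumes "\<pi> \<in> colored_perms l n"
  shows "circular_successions n k \<pi> = predicted (predict_circular (k + 1)) (one_line n \<pi>)"
proof (intro set_eqI iffI)
  fix v assume "v \<in> circular_successions n k \<pi>"
  then obtain i where "i \<in> {1..n}" "v = i + k" "letter_at \<pi> i = (1, i + k)"
    by (auto simp: circular_successions_def)
  then show "v \<in> predicted (predict_circular (k + 1)) (one_line n \<pi>)"
    by (auto simp: predicted_nth length_one_line nth_one_line predict_circular_def
        intro!: exI[of _ "i - 1"])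
next
  fix v assume "v \<in> predicted (predict_circular (k + 1)) (one_line n \<pi>)"
  then obtain i where i: "i < n" "v = Suc i + k" "letter_at \<pi> (Suc i) = (1, Suc i + k)"
    by (auto simp: predicted_nth length_one_line nth_one_line predict_circular_def)
  have "snd \<pi> permutes {1..n}" using assms by (auto simp: colored_perms_def)
  then have "snd \<pi> (Suc i) \<in> {1..n}" using i(1) by (subst permutes_in_image) auto
  then show "v \<in> circular_successions n k \<pi>"
    using i unfolding circular_successions_def letter_at_def
    by (intro CollectI exI[of _ "Suc i"]) auto
qed

lemma skew_linear_successions_predicted:
  "skew_linear_successions n k \<pi> = predicted (predict_linear k) (one_line n \<pi>)"
proof -
  have last: "last ((1, 0) # take i (one_line n \<pi>)) = letter_at0 \<pi> i" if "i < n" for i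
    using that by (cases i) (auto simp: letter_at0_def take_Suc_conv_app_nth length_one_line nth_one_line)
  show ?thesis
  proof (intro set_eqI iffI)
    fix v assume "v \<in> skew_linear_successions n k \<pi>"
    then obtain i where "i \<in> {1..n}" "v = snd (letter_at0 \<pi> i)"
      "letter_at0 \<pi> i = shift (letter_at0 \<pi> (i - 1)) k"
      by (auto simp: skew_linear_successions_def)
    then show "v \<in> predicted (predict_linear k) (one_line n \<pi>)"
      using last[of "i - 1"]
      by (auto simp: predicted_nth length_one_line nth_one_line predict_linear_def letter_at0_def
          simp del: last.simps intro!: exI[of _ "i - 1"])
  next
    fix v assume "v \<in> predicted (predict_linear k) (one_line n \<pi>)"
    then obtain i where "i < n" "v = snd (letter_at \<pi> (Suc i))"
      "letter_at \<pi> (Suc i) = shift (letter_at0 \<pi> i) k"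
      using last by (auto simp: predicted_nth length_one_line nth_one_line predict_linear_def)
    then show "v \<in> skew_linear_successions n k \<pi>"
      by (auto simp: skew_linear_successions_def letter_at0_def intro!: exI[of _ "Suc i"])
  qed
qed

lemma card_colored_perms_predicted:
  "card {\<pi> \<in> colored_perms l n. T \<subseteq> predicted h (one_line n \<pi>)} =
   card {w \<in> words (colors l) {1..n}. T \<subseteq> predicted h w}"
  using bij_betw_one_line[of n l]
  by (intro bij_betw_same_card[of "one_line n"]) (auto simp: bij_betw_def inj_on_def)

lemma bij_betw_circular_skew_linear:
  assumes l: "1 \<le> l"
  shows "\<exists>\<Psi>. bij_betw \<Psi> (colored_perms l n) (colored_perms l n) \<and>
    (\<forall>\<pi> \<in> colored_perms l n.
      skew_linear_successions n (k + 1) (\<Psi> \<pi>) = circular_successions n k \<pi>)"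
proof (rule bij_betw_if_card_fibres_eq[OF finite_colored_perms])
  fix T
  let ?X = "colored_perms l n" and ?U = "{k + 1..n}"
  let ?f = "circular_successions n k" and ?g = "skew_linear_successions n (k + 1)"
  have one: "1 \<in> colors l" using l by (auto simp: colors_def intro: exI[of _ 0])
  interpret C: prediction "colors l" "k + 1" "predict_circular (k + 1)"
    using one by (intro prediction_circular) auto
  interpret L: prediction "colors l" "k + 1" "predict_linear (k + 1)"
    using one by (intro prediction_linear) auto
  have f: "?f \<pi> \<subseteq> ?U" for \<pi> by (auto simp: circular_successions_def)
  have g: "?g \<pi> \<subseteq> ?U" if "\<pi> \<in> ?X" for \<pi>
  proof
    fix v assume v: "v \<in> ?g \<pi>"
    have s: "snd \<pi> permutes {1..n}" using that by (auto simp: colored_perms_def)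
    from v obtain i where "i \<in> {1..n}" "v = snd (letter_at0 \<pi> i)"
      "letter_at0 \<pi> i = shift (letter_at0 \<pi> (i - 1)) (k + 1)"
      by (auto simp: skew_linear_successions_def)
    then have "v = snd \<pi> i" "k + 1 \<le> v" by (auto simp: letter_at0_def letter_at_def shift_def)
    with permutes_in_image[OF s, of i] \<open>i \<in> {1..n}\<close> show "v \<in> ?U" by auto
  qed
  have sup: "card {\<pi> \<in> ?X. S \<subseteq> ?f \<pi>} = card {\<pi> \<in> ?X. S \<subseteq> ?g \<pi>}" if "S \<subseteq> ?U" for S
  proof -
    have S: "finite S" "\<And>v. v \<in> S \<Longrightarrow> {1..v} \<subseteq> {1..n} \<and> 1 \<le> v \<and> k + 1 \<le> v"
      using that finite_subset by (blast, fastforce)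
    show ?thesis
      using C.card_words_predicted[of S "{1..n}"] L.card_words_predicted[of S "{1..n}"] S
      by (simp add: circular_successions_predicted cong: conj_cong add: skew_linear_successions_predicted
          card_colored_perms_predicted)
  qed
  show "card {\<pi> \<in> ?X. ?f \<pi> = T} = card {\<pi> \<in> ?X. ?g \<pi> = T}"
  proof (cases "T \<subseteq> ?U")
    case True
    show ?thesis
      by (rule card_fibres_eq_if_card_supersets_eq[OF finite_colored_perms _ f g sup True]) auto
  next
    case False
    then have "{\<pi> \<in> ?X. ?f \<pi> = T} = {}" "{\<pi> \<in> ?X. ?g \<pi> = T} = {}" using f g by blast+
    then show ?thesis by (simp only:)
  qed
qed

section \<open>The rotation\<close>

lemma letter_at_delta:
  assumes "\<pi> \<in> colored_perms l n" and i: "i \<in> {1..n}"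
  shows "letter_at (delta l n \<pi>) i = letter_at \<pi> (if i = 1 then n else i - 1)"
proof -
  have n: "1 \<le> n" using i by simp
  have ne: "one_line n \<pi> \<noteq> []" using n length_one_line[of n \<pi>] by auto
  have "letter_at (delta l n \<pi>) i = (last (one_line n \<pi>) # butlast (one_line n \<pi>)) ! (i - 1)"
    using one_line_nth[OF i] one_line_delta[OF n assms(1)] by metis
  also have "\<dots> = letter_at \<pi> (if i = 1 then n else i - 1)"
    using i n ne
    by (auto simp: last_conv_nth length_one_line nth_Cons' nth_butlast nth_one_line
        Suc_diff_Suc numeral_2_eq_2)
  finally show ?thesis .
qed

lemma bij_betw_delta:
  assumes "1 \<le> n"
  shows "bij_betw (delta l n) (colored_perms l n) (colored_perms l n)"
proof -
  have "inj_on (delta l n) (colored_perms l n)"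
  proof (rule inj_onI)
    fix \<pi> \<rho> assume P: "\<pi> \<in> colored_perms l n" "\<rho> \<in> colored_perms l n"
      and eq: "delta l n \<pi> = delta l n \<rho>"
    have ne: "one_line n \<tau> \<noteq> []" for \<tau>
      using assms length_one_line[of n \<tau>] by auto
    have "one_line n \<pi> = one_line n \<rho>"
      using one_line_delta[OF assms P(1)] one_line_delta[OF assms P(2)] eq ne
      by (metis append_butlast_last_id list.inject)
    then show "\<pi> = \<rho>" using one_line_inj P by (metis inj_onD)
  qed
  then show ?thesis
    using delta_in[OF assms]
    by (simp add: bij_betw_def endo_inj_surj[OF finite_colored_perms] image_subset_iff)
qed

text \<open>
  Rotation moves the letter at position \<open>i\<close> to position \<open>i + 1\<close>, which lowers its excess over the position
  by one. The exception is the last letter, which comes to position \<open>1\<close> and can only contribute the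
  value \<open>k + 1\<close>.
\<close>

lemma circular_successions_delta:
  assumes "\<pi> \<in> colored_perms l n"
  shows "circular_successions n (k + 1) \<pi> = circular_successions n k (delta l n \<pi>) - {k + 1}"
proof (intro set_eqI iffI)
  fix v assume "v \<in> circular_successions n (k + 1) \<pi>"
  then obtain i where "i \<in> {1..n}" "v = i + (k + 1)" "v \<le> n" "letter_at \<pi> i = (1, v)"
    by (auto simp: circular_successions_def)
  then show "v \<in> circular_successions n k (delta l n \<pi>) - {k + 1}"
    by (auto simp: circular_successions_def letter_at_delta[OF assms] intro!: exI[of _ "i + 1"])
next
  fix v assume "v \<in> circular_successions n k (delta l n \<pi>) - {k + 1}"
  then obtain i where "i \<in> {1..n}" "v = i + k" "v \<le> n" "i \<noteq> 1"
    "letter_at (delta l n \<pi>) i = (1, v)"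
    by (auto simp: circular_successions_def)
  then show "v \<in> circular_successions n (k + 1) \<pi>"
    by (auto simp: circular_successions_def letter_at_delta[OF assms] intro!: exI[of _ "i - 1"])
qed

lemma linear_successions_skew:
  assumes "\<pi> \<in> colored_perms l n" and "1 \<le> n"
  shows "linear_successions n k \<pi> = skew_linear_successions n k \<pi> - {k}"
proof -
  have s: "snd \<pi> permutes {1..n}" using assms by (auto simp: colored_perms_def)
  have "k \<notin> linear_successions n k \<pi>"
  proof
    assume "k \<in> linear_successions n k \<pi>"
    then obtain i where "i \<in> {2..n}" "snd \<pi> (i - 1) = 0"
      by (auto simp: linear_successions_def letter_at_def shift_def)
    then show False using permutes_in_image[OF s, of "i - 1"] by auto
  qed
  then show ?thesis by (auto simp: skew_linear_successions_eq[OF assms(2)])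
qed

theorem theorem7:
  fixes l n k :: nat
  assumes "l \<ge> 1" and "n \<ge> 1"
  shows "\<exists>\<Phi>. bij_betw \<Phi> (colored_perms l n) (colored_perms l n) \<and>
    (\<forall>\<pi> \<in> colored_perms l n.
       circular_successions n (k + 1) \<pi> = linear_successions n (k + 1) (\<Phi> \<pi>) \<and>
       circular_successions n k (delta l n \<pi>) = skew_linear_successions n (k + 1) (\<Phi> \<pi>))"
proof -
  obtain \<Psi> where \<Psi>: "bij_betw \<Psi> (colored_perms l n) (colored_perms l n)"
    "\<And>\<pi>. \<pi> \<in> colored_perms l n \<Longrightarrow>
      skew_linear_successions n (k + 1) (\<Psi> \<pi>) = circular_successions n k \<pi>"
    using bij_betw_circular_skew_linear[OF assms(1)] by blast
  have bij: "bij_betw (\<Psi> \<circ> delta l n) (colored_perms l n) (colored_perms l n)"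
    by (rule bij_betw_trans[OF bij_betw_delta[OF assms(2)] \<Psi>(1)])
  have skew: "circular_successions n k (delta l n \<pi>)
      = skew_linear_successions n (k + 1) ((\<Psi> \<circ> delta l n) \<pi>)"
    if "\<pi> \<in> colored_perms l n" for \<pi>
    using \<Psi>(2) delta_in[OF assms(2) that] by simp
  have "circular_successions n (k + 1) \<pi> = linear_successions n (k + 1) ((\<Psi> \<circ> delta l n) \<pi>)"
    if "\<pi> \<in> colored_perms l n" for \<pi>
    using circular_successions_delta[OF that] skew[OF that]
      linear_successions_skew[OF bij_betwE[OF bij, rule_format, OF that] assms(2)] by simp
  with bij skew show ?thesis by blast
qed

end
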